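(* Let the coefficients $M_i(\tilde{\boldsymbol y})\ge 0$ ($\tilde{\boldsymbol y}\in Y$, $i\in I(\tilde{\boldsymbol y})$) satisfy $\varphi(\tilde{\boldsymbol y}^{\,S})\ge\varphi(\tilde{\boldsymbol y})-\sum_{i\in S}M_i(\tilde{\boldsymbol y})$ for all $\tilde{\boldsymbol y}\in Y$ and $S\subseteq I(\tilde{\boldsymbol y})$, where $\tilde{\boldsymbol y}^{\,S}$ is obtained from $\tilde{\boldsymbol y}$ by setting $\tilde y_i=0$ for $i\in S$. Then the cutting-plane algorithm with interdiction cuts described in the context terminates after finitely many iterations, and the blocker decision $\tilde{\boldsymbol x}$ it returns is an optimal solution of the Max-Min Covering Location Blocker Problem $$\min\Bigl\{\sum_{i\in I}e_ix_i:\ \xi(\boldsymbol x)\le t,\ \boldsymbol x\in\{0,1\}^m\Bigr\}.$$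
   Context: Data: $I=\{1,\dots,m\}$ is a finite set of candidate facility locations and $J=\{1,\dots,n\}$ a finite set of customers. Each $i\in I$ has an opening cost $f_i\ge 0$ and a blocking cost $e_i\ge 0$; each $j\in J$ has a weight $d_j>0$; $p_{ij}\in[0,1]$ is the coverage level provided by location $i$ to customer $j$; $b\ge 0$ is the opening budget and $t\ge 0$ the target coverage. Let $I_j=\{i\in I: 0<p_{ij}\le 1\}$. For $\boldsymbol y\in\{0,1\}^m$ let $I(\boldsymbol y)=\{i\in I:y_i=1\}$ and $I_j(\boldsymbol y)=I_j\cap I(\boldsymbol y)$. The (max-min) coverage of customer $j$ is $r_j(\boldsymbol y)=\min_{i\in I_j(\boldsymbol y)}p_{ij}$ if $I_j(\boldsymbol y)\neq\varnothing$, and $r_j(\boldsymbol y)=0$ otherwise. The total coverage is $\varphi(\boldsymbol y)=\sum_{j\in J}d_j r_j(\boldsymbol y)$. Let $Y=\{\boldsymbol y\in\{0,1\}^m:\sum_{i\in I}f_iy_i\le b\}$. For $\boldsymbol x\in\{0,1\}^m$ ($x_i=1$ means location $i$ is blocked), the optimal follower value is $\xi(\boldsymbol x)=\max\{\varphi(\boldsymbol y):\boldsymbol y\in Y,\ y_i\le 1-x_i\ \text{for all } i\in I\}$. Interdiction cut associated with $\tilde{\boldsymbol y}\in Y$: the inequality $t\ge\varphi(\tilde{\boldsymbol y})-\sum_{i\in I(\tilde{\boldsymbol y})}M_i(\tilde{\boldsymbol y})x_i$ in the variables $\boldsymbol x$. Cutting-plane algorithm: start with the relaxed upper-level problem $\min\{\sum_{i\in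 I}e_ix_i:\boldsymbol x\in\{0,1\}^m\}$ containing no interdiction cuts. In each iteration: (1) compute an optimal solution $\tilde{\boldsymbol x}$ of the current relaxed upper-level problem; (2) compute an optimal follower response $\tilde{\boldsymbol y}$ to $\tilde{\boldsymbol x}$, i.e. $\tilde{\boldsymbol y}\in Y$ with $\tilde y_i\le 1-\tilde x_i$ for all $i$ and $\varphi(\tilde{\boldsymbol y})=\xi(\tilde{\boldsymbol x})$; (3) if $\xi(\tilde{\boldsymbol x})\le t$, stop and return $\tilde{\boldsymbol x}$ (with $\tilde{\boldsymbol y}$ and its coverage vector); otherwise add the interdiction cut associated with $\tilde{\boldsymbol y}$ to the relaxed upper-level problem and repeat. *)

theory Defs
  imports Complex_Main "HOL-Library.FuncSet"
begin

record instance_data =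
  num_locations :: nat
  num_customers :: nat
  opening_cost :: "nat \<Rightarrow> real"
  blocking_cost :: "nat \<Rightarrow> real"
  weight :: "nat \<Rightarrow> real"
  coverage_level :: "nat \<Rightarrow> nat \<Rightarrow> real"
  budget :: real
  target :: real

definition locations :: "instance_data \<Rightarrow> nat set" where
  "locations P = {1..num_locations P}"

definition customers :: "instance_data \<Rightarrow> nat set" where
  "customers P = {1..num_customers P}"

definition valid_instance :: "instance_data \<Rightarrow> bool" where
  "valid_instance P \<longleftrightarrow>
     (\<forall>i\<in>locations P. 0 \<le> opening_cost P i) \<and>
     (\<forall>i\<in>locations P. 0 \<le> blocking_cost P i) \<and>
     (\<forall>j\<in>customers P. 0 < weight P j) \<and>
     (\<forall>i\<in>locations P. \<forall>j\<in>customers P. 0 \<le> coverage_level P i j \<and> coverage_level P i j \<le> 1) \<and>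
     0 \<le> budget P \<and> 0 \<le> target P"

text \<open>Vectors in \<open>{0,1}\<^sup>m\<close> are extensional functions, equal to \<^const>\<open>undefined\<close>
  outside \<open>{1..m}\<close>, so that this set is finite.\<close>

definition binary_vectors :: "instance_data \<Rightarrow> (nat \<Rightarrow> real) set" where
  "binary_vectors P = locations P \<rightarrow>\<^sub>E {0, 1}"

definition open_locations :: "instance_data \<Rightarrow> (nat \<Rightarrow> real) \<Rightarrow> nat set" where
  "open_locations P y = {i \<in> locations P. y i = 1}"

definition covering_locations :: "instance_data \<Rightarrow> nat \<Rightarrow> nat set" where
  "covering_locations P j =
     {i \<in> locations P. 0 < coverage_level P i j \<and> coverage_level P i j \<le> 1}"

definition open_covering_locations :: "instance_data \<Rightarrow> nat \<Rightarrow> (nat \<Rightarrow> real) \<Rightarrow> nat set" where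
  "open_covering_locations P j y = covering_locations P j \<inter> open_locations P y"

definition customer_coverage :: "instance_data \<Rightarrow> (nat \<Rightarrow> real) \<Rightarrow> nat \<Rightarrow> real" where
  "customer_coverage P y j =
     (if open_covering_locations P j y = {} then 0
      else Min ((\<lambda>i. coverage_level P i j) ` open_covering_locations P j y))"

definition total_coverage :: "instance_data \<Rightarrow> (nat \<Rightarrow> real) \<Rightarrow> real" where
  "total_coverage P y = (\<Sum>j\<in>customers P. weight P j * customer_coverage P y j)"

definition follower_decisions :: "instance_data \<Rightarrow> (nat \<Rightarrow> real) set" where
  "follower_decisions P =
     {y \<in> binary_vectors P. (\<Sum>i\<in>locations P. opening_cost P i * y i) \<le> budget P}"

definition follower_feasible :: "instance_data \<Rightarrow> (nat \<Rightarrow> real) \<Rightarrow> (nat \<Rightarrow> real) set" where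
  "follower_feasible P x = {y \<in> follower_decisions P. \<forall>i\<in>locations P. y i \<le> 1 - x i}"

definition follower_value :: "instance_data \<Rightarrow> (nat \<Rightarrow> real) \<Rightarrow> real" where
  "follower_value P x = Max (total_coverage P ` follower_feasible P x)"

definition optimal_response :: "instance_data \<Rightarrow> (nat \<Rightarrow> real) \<Rightarrow> (nat \<Rightarrow> real) \<Rightarrow> bool" where
  "optimal_response P x y \<longleftrightarrow>
     y \<in> follower_feasible P x \<and> total_coverage P y = follower_value P x"

definition total_blocking_cost :: "instance_data \<Rightarrow> (nat \<Rightarrow> real) \<Rightarrow> real" where
  "total_blocking_cost P x = (\<Sum>i\<in>locations P. blocking_cost P i * x i)"

definition optimal_blocking :: "instance_data \<Rightarrow> (nat \<Rightarrow> real) \<Rightarrow> bool" where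
  "optimal_blocking P x \<longleftrightarrow>
     is_arg_min (total_blocking_cost P)
       (\<lambda>x. follower_value P x \<le> target P \<and> x \<in> binary_vectors P) x"

definition close_locations :: "nat set \<Rightarrow> (nat \<Rightarrow> real) \<Rightarrow> nat \<Rightarrow> real" where
  "close_locations S y = (\<lambda>i. if i \<in> S then 0 else y i)"

definition interdiction_cut ::
    "instance_data \<Rightarrow> ((nat \<Rightarrow> real) \<Rightarrow> nat \<Rightarrow> real) \<Rightarrow> (nat \<Rightarrow> real) \<Rightarrow> (nat \<Rightarrow> real) \<Rightarrow> bool" where
  "interdiction_cut P M y x \<longleftrightarrow>
     target P \<ge> total_coverage P y - (\<Sum>i\<in>open_locations P y. M y i * x i)"

text \<open>The relaxed upper-level problem is determined by the set \<open>C\<close> of follower decisions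
  whose cuts have been added.\<close>

definition optimal_relaxed ::
    "instance_data \<Rightarrow> ((nat \<Rightarrow> real) \<Rightarrow> nat \<Rightarrow> real) \<Rightarrow> (nat \<Rightarrow> real) set \<Rightarrow> (nat \<Rightarrow> real) \<Rightarrow> bool" where
  "optimal_relaxed P M C x \<longleftrightarrow>
     is_arg_min (total_blocking_cost P)
       (\<lambda>x. x \<in> binary_vectors P \<and> (\<forall>y\<in>C. interdiction_cut P M y x)) x"

text \<open>A run is either about to solve the relaxed problem with cut set \<open>C\<close>, or has returned
  the blocker decision, the follower response and its coverage vector. One transition is one
  iteration; the choices of the optimal solutions in an iteration are nondeterministic.\<close>

datatype state =
    Relaxed "(nat \<Rightarrow> real) set"
  | Returned "nat \<Rightarrow> real" "nat \<Rightarrow> real" "nat \<Rightarrow> real"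

inductive iteration ::
    "instance_data \<Rightarrow> ((nat \<Rightarrow> real) \<Rightarrow> nat \<Rightarrow> real) \<Rightarrow> state \<Rightarrow> state \<Rightarrow> bool"
  for P M where
  stop: "\<lbrakk>optimal_relaxed P M C x; optimal_response P x y; follower_value P x \<le> target P\<rbrakk> \<Longrightarrow>
     iteration P M (Relaxed C) (Returned x y (restrict (customer_coverage P y) (customers P)))"
| add_cut: "\<lbrakk>optimal_relaxed P M C x; optimal_response P x y; \<not> follower_value P x \<le> target P\<rbrakk> \<Longrightarrow>
     iteration P M (Relaxed C) (Relaxed (insert y C))"

end

theory Submission
  imports Defs
begin

text \<open>
  The algorithm is correct because of two properties of interdiction cuts.

  A cut is valid: every blocker decision \<open>x\<close> with \<open>\<xi>(x) \<le> t\<close> satisfies every cut. Indeed, closing in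
  \<open>y\<close> the locations \<open>S\<close> that \<open>x\<close> blocks gives a feasible response to \<open>x\<close>, whose coverage is at most \<open>t\<close>,
  and the hypothesis on \<open>M\<close> bounds this coverage from below by the left-hand side of the cut
  (lemma \<open>interdiction_cut_valid\<close>). Hence every relaxed problem really is a relaxation. It is
  feasible, because blocking all locations leaves the follower with coverage \<open>0 \<le> t\<close>, and a solution
  of it that satisfies \<open>\<xi>(x) \<le> t\<close> is optimal for the blocker problem.

  A cut separates: if \<open>y\<close> is an optimal response to \<open>x\<close> and \<open>\<xi>(x) > t\<close>, then \<open>x\<close> blocks no location open
  in \<open>y\<close>, so the sum in the cut of \<open>y\<close> vanishes at \<open>x\<close> and the cut is violated there (lemma
  \<open>interdiction_cut_separates\<close>). As \<open>x\<close> satisfies the cuts found before, the cut of \<open>y\<close> is new. There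
  are only finitely many follower decisions, so only finitely many cuts can be added.
\<close>

section \<open>The follower problem\<close>

lemma finite_locations: "finite (locations P)"
  by (simp add: locations_def)

lemma open_locations_subset: "open_locations P y \<subseteq> locations P"
  by (auto simp: open_locations_def)

lemma finite_binary_vectors: "finite (binary_vectors P)"
  by (simp add: binary_vectors_def finite_PiE finite_locations)

lemma binary_vectors_cases:
  assumes "x \<in> binary_vectors P" "i \<in> locations P"
  shows "x i = 0 \<or> x i = 1"
  using assms by (auto simp: binary_vectors_def PiE_iff)

lemma finite_follower_decisions: "finite (follower_decisions P)"
  using finite_binary_vectors[of P] by (simp add: follower_decisions_def)

lemma follower_feasible_subset: "follower_feasible P x \<subseteq> follower_decisions P"
  by (auto simp: follower_feasible_def)

lemma finite_follower_feasible: "finite (follower_feasible P x)"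
  using follower_feasible_subset finite_follower_decisions by (rule finite_subset)

lemma closed_everywhere_feasible:
  assumes "valid_instance P" "x \<in> binary_vectors P"
  shows "restrict (\<lambda>_. 0) (locations P) \<in> follower_feasible P x"
proof -
  have "1 - x i \<ge> 0" if "i \<in> locations P" for i
    using binary_vectors_cases[OF assms(2) that] by auto
  then show ?thesis
    using assms(1)
    by (auto simp: follower_feasible_def follower_decisions_def binary_vectors_def valid_instance_def)
qed

lemma optimal_response_exists:
  assumes "valid_instance P" "x \<in> binary_vectors P"
  shows "\<exists>y. optimal_response P x y"
proof -
  have "follower_value P x \<in> total_coverage P ` follower_feasible P x"
    unfolding follower_value_def
    using closed_everywhere_feasible[OF assms] finite_follower_feasible by (intro Max_in) auto
  then show ?thesis by (auto simp: optimal_response_def)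
qed

lemma total_coverage_le_follower_value:
  assumes "y \<in> follower_feasible P x"
  shows "total_coverage P y \<le> follower_value P x"
  unfolding follower_value_def using assms finite_follower_feasible by (intro Max_ge) auto

lemma close_locations_feasible:
  assumes "valid_instance P" "x \<in> binary_vectors P" "y \<in> follower_decisions P"
    and S: "S \<subseteq> locations P" "\<And>i. i \<in> open_locations P y \<Longrightarrow> x i = 1 \<Longrightarrow> i \<in> S"
  shows "close_locations S y \<in> follower_feasible P x"
proof -
  have y: "y \<in> binary_vectors P"
    and budget: "(\<Sum>i\<in>locations P. opening_cost P i * y i) \<le> budget P"
    using assms(3) by (auto simp: follower_decisions_def)
  have "(\<Sum>i\<in>locations P. opening_cost P i * close_locations S y i)
      \<le> (\<Sum>i\<in>locations P. opening_cost P i * y i)"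
  proof (rule sum_mono)
    fix i assume i: "i \<in> locations P"
    have "0 \<le> opening_cost P i"
      using assms(1) i by (auto simp: valid_instance_def)
    then show "opening_cost P i * close_locations S y i \<le> opening_cost P i * y i"
      using binary_vectors_cases[OF y i] by (auto simp: close_locations_def)
  qed
  moreover have "close_locations S y \<in> binary_vectors P"
    using y S(1) unfolding binary_vectors_def close_locations_def
    by (auto simp: PiE_iff extensional_def)
  moreover have "close_locations S y i \<le> 1 - x i" if i: "i \<in> locations P" for i
    using S(2)[of i] i binary_vectors_cases[OF y i] binary_vectors_cases[OF assms(2) i]
    by (auto simp: close_locations_def open_locations_def)
  ultimately show ?thesis
    using budget by (auto simp: follower_feasible_def follower_decisions_def)
qed

text \<open>A follower facing a complete blockade can open nothing, and the target is nonnegative. As cuts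
  are valid, the complete blockade is then a feasible point of every relaxed problem.\<close>

lemma follower_value_block_all:
  assumes "valid_instance P"
  shows "follower_value P (restrict (\<lambda>_. 1) (locations P)) \<le> target P"
proof -
  let ?x = "restrict (\<lambda>_. 1) (locations P) :: nat \<Rightarrow> real"
  have x: "?x \<in> binary_vectors P" by (auto simp: binary_vectors_def)
  obtain y where y: "optimal_response P ?x y"
    using optimal_response_exists[OF assms x] by blast
  then have "open_locations P y = {}"
    by (fastforce simp: optimal_response_def follower_feasible_def open_locations_def)
  then have "total_coverage P y = 0"
    by (simp add: total_coverage_def customer_coverage_def open_covering_locations_def)
  then show ?thesis
    using y assms by (simp add: optimal_response_def valid_instance_def)
qed

section \<open>Interdiction cuts\<close>

text \<open>The sum in the cut runs over the blocked open locations only, since \<open>x\<close> is binary; closing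
  exactly these turns \<open>y\<close> into a feasible response to \<open>x\<close>.\<close>

lemma interdiction_cut_valid:
  assumes "valid_instance P"
    and M: "\<And>S. S \<subseteq> open_locations P y \<Longrightarrow>
          total_coverage P (close_locations S y) \<ge> total_coverage P y - (\<Sum>i\<in>S. M y i)"
    and y: "y \<in> follower_decisions P"
    and x: "x \<in> binary_vectors P" "follower_value P x \<le> target P"
  shows "interdiction_cut P M y x"
proof -
  define S where "S = {i \<in> open_locations P y. x i = 1}"
  have fin: "finite (open_locations P y)"
    using open_locations_subset finite_locations by (rule finite_subset)
  have "(\<Sum>i\<in>open_locations P y. M y i * x i)
      = (\<Sum>i\<in>open_locations P y. if x i = 1 then M y i else 0)"
    using binary_vectors_cases[OF x(1)] open_locations_subset by (intro sum.cong) fastforce+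
  also have "\<dots> = (\<Sum>i\<in>S. M y i)"
    using fin by (simp add: S_def sum.inter_filter)
  finally have sum_eq: "(\<Sum>i\<in>open_locations P y. M y i * x i) = (\<Sum>i\<in>S. M y i)" .
  have "total_coverage P y - (\<Sum>i\<in>S. M y i) \<le> total_coverage P (close_locations S y)"
    by (rule M) (auto simp: S_def)
  also have "\<dots> \<le> follower_value P x"
    using assms(1) x(1) y open_locations_subset
    by (intro total_coverage_le_follower_value close_locations_feasible) (auto simp: S_def)
  finally show ?thesis
    using x(2) by (simp add: interdiction_cut_def sum_eq)
qed

lemma interdiction_cut_separates:
  assumes "x \<in> binary_vectors P" "optimal_response P x y" "\<not> follower_value P x \<le> target P"
  shows "\<not> interdiction_cut P M y x"
proof -
  have "x i = 0" if i: "i \<in> open_locations P y" for i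
  proof -
    have "i \<in> locations P" "y i = 1"
      using i by (auto simp: open_locations_def)
    then show ?thesis
      using assms(2) binary_vectors_cases[OF assms(1), of i]
      by (fastforce simp: optimal_response_def follower_feasible_def)
  qed
  then show ?thesis
    using assms(2,3) by (simp add: interdiction_cut_def optimal_response_def)
qed

section \<open>Termination and correctness of the algorithm\<close>

lemma optimal_relaxed_exists:
  assumes "x \<in> binary_vectors P" "\<forall>y\<in>C. interdiction_cut P M y x"
  shows "\<exists>x. optimal_relaxed P M C x"
proof -
  let ?X = "{x \<in> binary_vectors P. \<forall>y\<in>C. interdiction_cut P M y x}"
  have "finite ?X" "?X \<noteq> {}"
    using finite_binary_vectors[of P] assms by auto
  then obtain x where "is_arg_min (total_blocking_cost P) (\<lambda>x. x \<in> ?X) x"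
    using ex_is_arg_min_if_finite by blast
  then show ?thesis by (auto simp: optimal_relaxed_def)
qed

text \<open>The set of cuts as a progress measure: the cut added in an iteration cuts off the current
  solution, which all the earlier cuts keep.\<close>

lemma iteration_adds_new_cut:
  assumes "iteration P M (Relaxed C) (Relaxed C')"
  shows "\<exists>y \<in> follower_decisions P - C. C' = insert y C"
  using assms
proof cases
  case (add_cut x y)
  then have "x \<in> binary_vectors P" "\<forall>z\<in>C. interdiction_cut P M z x"
    by (auto simp: optimal_relaxed_def is_arg_min_def)
  moreover have "y \<in> follower_decisions P"
    using add_cut follower_feasible_subset by (auto simp: optimal_response_def)
  ultimately show ?thesis
    using add_cut interdiction_cut_separates[of x P y M] by blast
qed

lemma no_iteration_from_Returned: "\<not> iteration P M (Returned x y r) s"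
  by (auto elim: iteration.cases)

lemma no_infinite_run: "\<not> (\<exists>s. s 0 = Relaxed {} \<and> (\<forall>k::nat. iteration P M (s k) (s (Suc k))))"
proof
  assume "\<exists>s. s 0 = Relaxed {} \<and> (\<forall>k::nat. iteration P M (s k) (s (Suc k)))"
  then obtain s where s0: "s 0 = Relaxed {}" and step: "\<And>k::nat. iteration P M (s k) (s (Suc k))"
    by blast
  have cuts: "\<exists>C. s k = Relaxed C \<and> C \<subseteq> follower_decisions P \<and> card C = k" for k
  proof (induction k)
    case 0
    then show ?case using s0 by simp
  next
    case (Suc k)
    then obtain C where C: "s k = Relaxed C" "C \<subseteq> follower_decisions P" "card C = k" by blast
    obtain C' where C': "s (Suc k) = Relaxed C'"
      using step[of "Suc k"] no_iteration_from_Returned by (cases "s (Suc k)") auto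
    obtain y where "y \<in> follower_decisions P - C" "C' = insert y C"
      using iteration_adds_new_cut step[of k] C(1) C' by metis
    moreover have "finite C"
      using C(2) finite_follower_decisions by (rule finite_subset)
    ultimately show ?case using C C' by auto
  qed
  obtain C where "C \<subseteq> follower_decisions P" "card C = Suc (card (follower_decisions P))"
    using cuts by blast
  then show False
    using card_mono[OF finite_follower_decisions, of C P] by simp
qed

text \<open>A solution of the relaxation that is feasible for the blocker problem is optimal for it,
  because every competitor is feasible for the relaxation.\<close>

lemma optimal_relaxed_imp_optimal_blocking:
  assumes opt: "optimal_relaxed P M C x" and "follower_value P x \<le> target P"
    and valid: "\<And>x' y. x' \<in> binary_vectors P \<Longrightarrow> follower_value P x' \<le> target P \<Longrightarrow> y \<in> C \<Longrightarrow>
      interdiction_cut P M y x'"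
  shows "optimal_blocking P x"
  using assms unfolding optimal_relaxed_def optimal_blocking_def is_arg_min_def by blast

theorem mainTheorem5:
  fixes P :: instance_data and M :: "(nat \<Rightarrow> real) \<Rightarrow> nat \<Rightarrow> real"
  assumes "valid_instance P"
    and "\<forall>y\<in>follower_decisions P. \<forall>i\<in>open_locations P y. 0 \<le> M y i"
    and "\<forall>y\<in>follower_decisions P. \<forall>S. S \<subseteq> open_locations P y \<longrightarrow>
           total_coverage P (close_locations S y) \<ge> total_coverage P y - (\<Sum>i\<in>S. M y i)"
  shows "\<not> (\<exists>s. s 0 = Relaxed {} \<and> (\<forall>k::nat. iteration P M (s k) (s (Suc k)))) \<and>
         (\<forall>s. (iteration P M)\<^sup>*\<^sup>* (Relaxed {}) s \<longrightarrow>
            (\<exists>x y r. s = Returned x y r) \<or> (\<exists>s'. iteration P M s s')) \<and>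
         (\<forall>x y r. (iteration P M)\<^sup>*\<^sup>* (Relaxed {}) (Returned x y r) \<longrightarrow> optimal_blocking P x)"
proof (intro conjI allI impI)
  show "\<not> (\<exists>s. s 0 = Relaxed {} \<and> (\<forall>k::nat. iteration P M (s k) (s (Suc k))))"
    by (rule no_infinite_run)
next
  have valid: "interdiction_cut P M y x"
    if "y \<in> follower_decisions P" "x \<in> binary_vectors P" "follower_value P x \<le> target P" for x y
    using interdiction_cut_valid[OF assms(1) _ that] assms(3) that(1) by blast
  define inv where "inv s \<longleftrightarrow>
    (case s of Relaxed C \<Rightarrow> C \<subseteq> follower_decisions P | Returned x y r \<Rightarrow> optimal_blocking P x)" for s
  have reach: "inv s" if "(iteration P M)\<^sup>*\<^sup>* (Relaxed {}) s" for s
    using that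
  proof (induction rule: rtranclp_induct)
    case base
    then show ?case by (simp add: inv_def)
  next
    case (step s s')
    from step.hyps(2) show ?case
    proof cases
      case (stop C x y)
      then have "C \<subseteq> follower_decisions P"
        using step.IH by (simp add: inv_def)
      then have "optimal_blocking P x"
        using optimal_relaxed_imp_optimal_blocking[OF stop(3,5)] valid by blast
      then show ?thesis
        using stop by (simp add: inv_def)
    next
      case (add_cut C x y)
      then show ?thesis
        using step.IH follower_feasible_subset by (auto simp: inv_def optimal_response_def)
    qed
  qed
  show "(\<exists>x y r. s = Returned x y r) \<or> (\<exists>s'. iteration P M s s')"
    if "(iteration P M)\<^sup>*\<^sup>* (Relaxed {}) s" for s
  proof (cases s)
    case (Relaxed C)
    then have C: "C \<subseteq> follower_decisions P"
      using reach[OF that] by (simp add: inv_def)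
    let ?all = "restrict (\<lambda>_. 1) (locations P) :: nat \<Rightarrow> real"
    have "?all \<in> binary_vectors P" by (auto simp: binary_vectors_def)
    then obtain x where x: "optimal_relaxed P M C x"
      using optimal_relaxed_exists[of ?all P C M] valid follower_value_block_all[OF assms(1)] C
      by blast
    then obtain y where "optimal_response P x y"
      using optimal_response_exists[OF assms(1), of x]
      by (auto simp: optimal_relaxed_def is_arg_min_def)
    with x show ?thesis
      unfolding Relaxed by (meson iteration.intros)
  qed simp
  show "optimal_blocking P x" if "(iteration P M)\<^sup>*\<^sup>* (Relaxed {}) (Returned x y r)" for x y r
    using reach[OF that] by (simp add: inv_def)
qed

end
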